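(* Let $P,Q\in\mathbb{Z}$ with $PQ\neq 0$, let $p$ be a prime dividing both $P$ and $Q$, and write $P=p^aP'$, $Q=p^bQ'$ with $a,b\geq 1$ and $p\nmid P'Q'$. If $b>2a$ and $r\geq 1$ is an integer, then $\mathcal{L}(P,Q,p^{-r})=S_{\lceil (r+a)/a\rceil}$.
   Context: $\mathbb{N}=\{0,1,2,\ldots\}$. For $P,Q\in\mathbb{Z}$, the Lucas sequence $U_n=U_n(P,Q)$ is defined by $U_0=0$, $U_1=1$, $U_{n+2}=PU_{n+1}-QU_n$. For $R\in\mathbb{Q}$, $\mathcal{L}(P,Q,R)=\{n\in\mathbb{N} : U_nR\in\mathbb{Z}\}$. For $m\geq 1$, $S_m=\{0,m,m+1,m+2,\ldots\}$. *)

theory Defs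
  imports Complex_Main "HOL-Computational_Algebra.Primes"
begin

fun lucas_U :: "int \<Rightarrow> int \<Rightarrow> nat \<Rightarrow> int" where
  "lucas_U P Q 0 = 0"
| "lucas_U P Q (Suc 0) = 1"
| "lucas_U P Q (Suc (Suc n)) = P * lucas_U P Q (Suc n) - Q * lucas_U P Q n"

definition lucas_L :: "int \<Rightarrow> int \<Rightarrow> rat \<Rightarrow> nat set" where
  "lucas_L P Q R = {n. of_int (lucas_U P Q n) * R \<in> \<int>}"

definition S :: "nat \<Rightarrow> nat set" where
  "S m = {0} \<union> {m..}"

end

theory Submission imports Defs begin

text \<open>
  Rescaling the parameters gives $U_{n+1}(cP, c^2Q) = c^n U_{n+1}(P, Q)$. Since $b > 2a$, taking
  $c = p^a$ leaves the parameters $P'$ and $p^{b-2a}Q'$, the second of which is divisible by $p$.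
  Modulo $p$ the remaining sequence is $P'^n$, so the exact power of $p$ in $U_{n+1}$ is $p^{an}$.
\<close>

text \<open>With weight 1 for \<open>P\<close> and weight 2 for \<open>Q\<close>, both terms of the
  recurrence have the same weight, so the value at index \<open>Suc n\<close> is homogeneous of
  degree \<open>n\<close>. The shifted index keeps this degree a natural number.\<close>

lemma lucas_U_scale:
  "lucas_U (c * P) (c\<^sup>2 * Q) (Suc n) = c ^ n * lucas_U P Q (Suc n)"
proof (induction n rule: induct_nat_012)
  case (ge2 n)
  then show ?case by (simp add: algebra_simps power2_eq_square)
qed simp_all

lemma prime_not_dvd_lucas_U:
  assumes "prime p" "\<not> p dvd P" "p dvd Q"
  shows "\<not> p dvd lucas_U P Q (Suc n)"
proof (induction n)
  case 0
  show ?case using assms(1) not_prime_unit by auto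
next
  case (Suc n)
  have "\<not> p dvd P * lucas_U P Q (Suc n)"
    using assms Suc by (simp add: prime_dvd_mult_iff)
  moreover have "p dvd Q * lucas_U P Q n"
    using assms by simp
  ultimately show ?case
    by (simp add: dvd_diff_right_iff dvd_diff_left_iff)
qed

text \<open>Since \<open>v\<close> is coprime to every power of \<open>p\<close>, it can be
  cancelled, which leaves a comparison of exponents.\<close>

lemma prime_power_dvd_mult_iff:
  fixes p v :: int
  assumes "prime p" "\<not> p dvd v"
  shows "p ^ r dvd p ^ k * v \<longleftrightarrow> r \<le> k"
proof
  assume "p ^ r dvd p ^ k * v"
  moreover have "coprime (p ^ r) v"
    using assms by (simp add: prime_imp_coprime)
  ultimately have "p ^ r dvd p ^ k"
    by (simp add: coprime_dvd_mult_left_iff)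
  moreover have "p \<noteq> 0" "\<not> is_unit p"
    using assms(1) by (auto simp: not_prime_unit)
  ultimately show "r \<le> k"
    by (simp add: dvd_power_iff)
qed (simp add: le_imp_power_dvd)

lemma of_int_mult_powi_neg_in_Ints_iff:
  fixes u p :: int
  assumes "p \<noteq> 0"
  shows "(of_int u * of_int p powi (- int r) :: rat) \<in> \<int> \<longleftrightarrow> p ^ r dvd u"
proof -
  have "(of_int u * of_int p powi (- int r) :: rat) = of_int u / of_int (p ^ r)"
    by (simp add: power_int_minus field_simps)
  then show ?thesis
    using assms by (simp only: of_int_div_of_int_in_Ints_iff) simp
qed

text \<open>Clearing the denominator gives r + a \<le> a(n + 1). The summand \<open>a\<close> in the
  numerator is thus exactly what absorbs the shift between the index \<open>Suc n\<close> and the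
  exponent \<open>a * n\<close>.\<close>

lemma nat_ceiling_add_divide_le_Suc_iff:
  assumes "a \<ge> 1"
  shows "nat \<lceil>(of_nat r + of_nat a) / (of_nat a :: rat)\<rceil> \<le> Suc n \<longleftrightarrow> r \<le> a * n"
proof -
  have "nat \<lceil>(of_nat r + of_nat a) / (of_nat a :: rat)\<rceil> \<le> Suc n
      \<longleftrightarrow> (of_nat r + of_nat a) / of_nat a \<le> (of_nat (Suc n) :: rat)"
    by (simp add: nat_le_iff ceiling_le_iff)
  also have "\<dots> \<longleftrightarrow> (of_nat (r + a) :: rat) \<le> of_nat (a * Suc n)"
    using assms by (simp add: field_simps)
  also have "\<dots> \<longleftrightarrow> r \<le> a * n"
    by (simp only: of_nat_le_iff) simp
  finally show ?thesis .
qed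

theorem theorem5p2:
  fixes P Q P' Q' p :: int and a b r :: nat
  assumes "P * Q \<noteq> 0"
    and "prime p"
    and "p dvd P" and "p dvd Q"
    and "P = p ^ a * P'" and "Q = p ^ b * Q'"
    and "a \<ge> 1" and "b \<ge> 1"
    and "\<not> p dvd P' * Q'"
    and "b > 2 * a"
    and "r \<ge> 1"
  shows "lucas_L P Q (of_int p powi (- int r)) = S (nat \<lceil>(of_nat r + of_nat a) / (of_nat a :: rat)\<rceil>)"
    (is "?L = S ?m")
proof -
  define Q'' where "Q'' = p ^ (b - 2 * a) * Q'"
  \<comment> \<open>The subtraction on naturals does not truncate because b > 2a. The order
    \<open>a * 2\<close> lets \<open>power_mult\<close> produce the square of
    \<open>p ^ a\<close>.\<close>
  have "b = a * 2 + (b - 2 * a)" using assms by simp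
  then have Q: "Q = (p ^ a)\<^sup>2 * Q''"
    unfolding Q''_def \<open>Q = _\<close> by (metis mult.assoc power_add power_mult)
  have "\<not> p dvd P'" using assms by auto
  \<comment> \<open>The strict inequality b > 2a leaves at least one factor \<open>p\<close> in
    \<open>Q''\<close>.\<close>
  moreover have "p dvd Q''" using assms by (simp add: Q''_def)
  ultimately have *: "\<not> p dvd lucas_U P' Q'' (Suc n)" for n
    using \<open>prime p\<close> by (intro prime_not_dvd_lucas_U)
  have U: "lucas_U P Q (Suc n) = p ^ (a * n) * lucas_U P' Q'' (Suc n)" for n
    unfolding Q \<open>P = _\<close> lucas_U_scale by (simp add: power_mult)
  have "p \<noteq> 0" using \<open>prime p\<close> by auto
  have "n \<in> ?L \<longleftrightarrow> n \<in> S ?m" for n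
  \<comment> \<open>Index 0 lies in both sets, as the sequence vanishes there; the exact power of
    \<open>p\<close> is only available at positive indices.\<close>
  proof (cases n)
    case 0
    then show ?thesis by (simp add: lucas_L_def S_def)
  next
    case (Suc k)
    have "n \<in> ?L \<longleftrightarrow> p ^ r dvd lucas_U P Q (Suc k)"
      using \<open>p \<noteq> 0\<close> unfolding lucas_L_def Suc mem_Collect_eq
      by (rule of_int_mult_powi_neg_in_Ints_iff)
    also have "\<dots> \<longleftrightarrow> r \<le> a * k"
      unfolding U using \<open>prime p\<close> * by (rule prime_power_dvd_mult_iff)
    also have "\<dots> \<longleftrightarrow> ?m \<le> Suc k"
      using \<open>a \<ge> 1\<close> by (rule nat_ceiling_add_divide_le_Suc_iff[symmetric])
    also have "\<dots> \<longleftrightarrow> n \<in> S ?m"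
      by (simp add: S_def Suc)
    finally show ?thesis .
  qed
  then show ?thesis by blast
qed

end
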